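(* Let $A,\bar A\in\mathbb R^{n\times n}$, $B,\bar B\in\mathbb R^{n\times m}$ with $\operatorname{rank}(\bar B)=n$; fix an invertible $M\in\mathbb R^{m\times m}$ with $\bar BM=[\,I_n\ \ 0\,]$ and write $BM=[\,L\ \ F\,]$ with $L\in\mathbb R^{n\times n}$, $F\in\mathbb R^{n\times (m-n)}$. Assume $A-L\bar A$ is invertible and put $C=(A-L\bar A)^{-1}$, $\bar C=-(A-L\bar A)^{-1}L$, $D=-(A-L\bar A)^{-1}F$, $C(k)=C+\bar Cw(k)$. Then the system governed by the backward stochastic difference equation $$x(k)=Cx(k+1)+\bar Cz(k)+Dv(k)-Cw(k)z(k)$$ is exactly null controllable if and only if there exists a positive integer $N$ such that the Gramian matrix $$G_N=\sum_{i=0}^N E\big[C(0)C(1)\cdots C(i-1)DD'C'(i-1)\cdots C'(0)\big]$$ is invertible (the product $C(0)\cdots C(i-1)$ is $I_n$ when $i=0$).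
   Context: Prime denotes transpose. $w(0),w(1),\dots$ are i.i.d. real random variables with zero mean and unit variance on a complete probability space; $\mathcal F(k)=\sigma\{w(0),\dots,w(k)\}$ and $\mathcal F(-1)$ is trivial. $[0,N]=\{0,1,\dots,N\}$. $l^2_{\mathcal F}([0,N],\mathbb R^s)$ is the space of processes $(m(k))_{k\in[0,N]}$ with $m(k)$ an $\mathbb R^s$-valued square integrable $\mathcal F(k-1)$-measurable random vector for each $k$. The backward system is exactly null controllable if for every nonzero $x\in\mathbb R^n$ there exist a positive integer $N$, a control $v\in l^2_{\mathcal F}([0,N],\mathbb R^{m-n})$, and processes $(x(k))_{k\in[0,N+1]}\in l^2_{\mathcal F}([0,N+1],\mathbb R^n)$, $(z(k))_{k\in[0,N]}\in l^2_{\mathcal F}([0,N],\mathbb R^n)$ satisfying the backward equation for all $k\in[0,N]$ (a.s.), with $x(0)=x$ and $x(N+1)=0$. (This backward equation is a rewriting of the forward system $x(k+1)=[Ax(k)+Bu(k)]+w(k)[\bar Ax(k)+\bar Bu(k)]$ via $u(k)=M\,[q(k)'\ \ v(k)']'$, $z(k)=\bar Ax(k)+q(k)$.) *)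

theory Defs
  imports
    "HOL-Probability.Probability"
    "Jordan_Normal_Form.DL_Rank"
begin

unbundle no vec_syntax

text \<open>
  Matrices and vectors are those of \<^theory>\<open>Jordan_Normal_Form.Matrix\<close>, so that the
  dimensions are natural numbers and the control dimension \<open>m - n\<close> is allowed to be \<open>0\<close>.
\<close>

definition append_cols :: "'a :: zero mat \<Rightarrow> 'a mat \<Rightarrow> 'a mat" (infixr \<open>@\<^sub>c\<close> 65) where
  "X @\<^sub>c Y = four_block_mat X Y (0\<^sub>m 0 (dim_col X)) (0\<^sub>m 0 (dim_col Y))"

definition standard_noise :: "'a measure \<Rightarrow> (nat \<Rightarrow> 'a \<Rightarrow> real) \<Rightarrow> bool" where
  "standard_noise P w \<longleftrightarrow>
     prob_space.indep_vars P (\<lambda>_. borel) w UNIV \<and>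
     (\<forall>k. distr P borel (w k) = distr P borel (w 0)) \<and>
     (\<forall>k. integrable P (w k) \<and> prob_space.expectation P (w k) = 0) \<and>
     (\<forall>k. integrable P (\<lambda>\<omega>. (w k \<omega>)\<^sup>2) \<and> prob_space.variance P (w k) = 1)"

text \<open>
  The index is shifted by one: \<open>past P w k\<close> is generated by \<open>w 0, \<dots>, w (k - 1)\<close>, that is, it is
  \<open>\<F>(k - 1)\<close>; for \<open>k = 0\<close> the generating family is empty and the \<open>\<sigma>\<close>-algebra is trivial.
\<close>

definition past :: "'a measure \<Rightarrow> (nat \<Rightarrow> 'a \<Rightarrow> real) \<Rightarrow> nat \<Rightarrow> 'a measure" where
  "past P w k = sigma (space P) {w j -` S \<inter> space P | j S. j < k \<and> S \<in> sets borel}"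

text \<open>
  \<open>l2_adapted P w N s\<close> is \<open>l\<^sup>2\<^bsub>\<F>\<^esub>([0,N], \<real>\<^sup>s)\<close>. Measurability and square integrability of a random
  vector are expressed through its \<open>s\<close> coordinates; values at times beyond \<open>N\<close> are irrelevant.
\<close>

definition l2_adapted ::
  "'a measure \<Rightarrow> (nat \<Rightarrow> 'a \<Rightarrow> real) \<Rightarrow> nat \<Rightarrow> nat \<Rightarrow> (nat \<Rightarrow> 'a \<Rightarrow> real Matrix.vec) set" where
  "l2_adapted P w N s = {q. \<forall>k\<in>{0..N}.
     (\<forall>\<omega>\<in>space P. q k \<omega> \<in> carrier_vec s) \<and>
     (\<forall>i<s. (\<lambda>\<omega>. q k \<omega> $ i) \<in> borel_measurable (past P w k) \<and>
            integrable P (\<lambda>\<omega>. (q k \<omega> $ i)\<^sup>2))}"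

definition backward_equation ::
  "'a measure \<Rightarrow> (nat \<Rightarrow> 'a \<Rightarrow> real) \<Rightarrow> real mat \<Rightarrow> real mat \<Rightarrow> real mat \<Rightarrow> nat \<Rightarrow>
   (nat \<Rightarrow> 'a \<Rightarrow> real Matrix.vec) \<Rightarrow> (nat \<Rightarrow> 'a \<Rightarrow> real Matrix.vec) \<Rightarrow>
   (nat \<Rightarrow> 'a \<Rightarrow> real Matrix.vec) \<Rightarrow> bool" where
  "backward_equation P w C Cbar D N x z v \<longleftrightarrow>
     (\<forall>k\<in>{0..N}. AE \<omega> in P.
        x k \<omega> = C *\<^sub>v x (k + 1) \<omega> + Cbar *\<^sub>v z k \<omega> + D *\<^sub>v v k \<omega> - w k \<omega> \<cdot>\<^sub>v (C *\<^sub>v z k \<omega>))"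

text \<open>\<open>n\<close> is the dimension of the state, \<open>p\<close> that of the control.\<close>

definition exactly_null_controllable ::
  "'a measure \<Rightarrow> (nat \<Rightarrow> 'a \<Rightarrow> real) \<Rightarrow> nat \<Rightarrow> nat \<Rightarrow> real mat \<Rightarrow> real mat \<Rightarrow> real mat \<Rightarrow> bool" where
  "exactly_null_controllable P w n p C Cbar D \<longleftrightarrow>
     (\<forall>x0\<in>carrier_vec n. x0 \<noteq> 0\<^sub>v n \<longrightarrow>
       (\<exists>N>0. \<exists>v\<in>l2_adapted P w N p. \<exists>x\<in>l2_adapted P w (N + 1) n. \<exists>z\<in>l2_adapted P w N n.
          backward_equation P w C Cbar D N x z v \<and>
          (AE \<omega> in P. x 0 \<omega> = x0) \<and>
          (AE \<omega> in P. x (N + 1) \<omega> = 0\<^sub>v n)))"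

definition noise_mat ::
  "(nat \<Rightarrow> 'a \<Rightarrow> real) \<Rightarrow> real mat \<Rightarrow> real mat \<Rightarrow> nat \<Rightarrow> 'a \<Rightarrow> real mat" where
  "noise_mat w C Cbar k \<omega> = C + w k \<omega> \<cdot>\<^sub>m Cbar"

text \<open>Ordered product of a list of \<open>n \<times> n\<close> matrices.\<close>

definition mat_prod_list :: "nat \<Rightarrow> real mat list \<Rightarrow> real mat" where
  "mat_prod_list n Xs = foldr (*) Xs (1\<^sub>m n)"

definition gramian_integrand ::
  "(nat \<Rightarrow> 'a \<Rightarrow> real) \<Rightarrow> nat \<Rightarrow> real mat \<Rightarrow> real mat \<Rightarrow> real mat \<Rightarrow> nat \<Rightarrow> 'a \<Rightarrow> real mat" where
  "gramian_integrand w n C Cbar D i \<omega> =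
     mat_prod_list n (map (\<lambda>k. noise_mat w C Cbar k \<omega>) [0..<i]) * (D * D\<^sup>T) *
     mat_prod_list n (map (\<lambda>k. (noise_mat w C Cbar k \<omega>)\<^sup>T) (rev [0..<i]))"

definition expectation_mat :: "'a measure \<Rightarrow> nat \<Rightarrow> ('a \<Rightarrow> real mat) \<Rightarrow> real mat" where
  "expectation_mat P n X = mat n n (\<lambda>(a, b). prob_space.expectation P (\<lambda>\<omega>. X \<omega> $$ (a, b)))"

text \<open>The sum of matrices is written entrywise since \<open>mat\<close> is not an additive monoid type.\<close>

definition gramian ::
  "'a measure \<Rightarrow> (nat \<Rightarrow> 'a \<Rightarrow> real) \<Rightarrow> nat \<Rightarrow> real mat \<Rightarrow> real mat \<Rightarrow> real mat \<Rightarrow> nat \<Rightarrow> real mat" where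
  "gramian P w n C Cbar D N =
     mat n n (\<lambda>(a, b). \<Sum>i=0..N. expectation_mat P n (gramian_integrand w n C Cbar D i) $$ (a, b))"

end

theory Submission
  imports Defs
begin

unbundle no inner_syntax

text \<open>
  The adjoint state \<open>r\<^sub>k = C(k - 1)' \<dots> C(0)' y\<close> satisfies \<open>r\<^sub>k\<^sub>+\<^sub>1 = C' r\<^sub>k + w(k) Cbar' r\<^sub>k\<close>. Since \<open>w(k)\<close> is
  independent of the past with mean \<open>0\<close> and variance \<open>1\<close>, the quadratic form \<open>E[r\<^sub>k' X r\<^sub>k]\<close> propagates
  through \<open>T(X) = C X C' + Cbar X Cbar'\<close>, so that the Gramian is \<open>S\<^sub>N\<^sub>+\<^sub>1 = \<Sum>i\<le>N. T\<^sup>i(D D')\<close> and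
  \<open>S\<^sub>j\<^sub>+\<^sub>1 = D D' + T(S\<^sub>j)\<close>.

  If \<open>S\<^sub>N\<^sub>+\<^sub>1 y = x\<^sub>0\<close>, this recursion says that \<open>x(k) = S\<^bsub>N+1-k\<^esub> r\<^sub>k\<close>, \<open>z(k) = S\<^bsub>N-k\<^esub> Cbar' r\<^sub>k\<close> and
  \<open>v(k) = D' r\<^sub>k\<close> solve the backward equation pointwise, with \<open>x(N + 1) = S\<^sub>0 r\<^sub>N\<^sub>+\<^sub>1 = 0\<close>.

  Conversely, \<open>E[r\<^sub>k\<^sub>+\<^sub>1' x(k + 1)] = E[r\<^sub>k' x(k)] - E[r\<^sub>k' D v(k)]\<close> along every solution. If \<open>y\<close> lies in the
  kernel of the Gramian, then \<open>D' r\<^sub>k = 0\<close> almost surely, hence \<open>y \<bullet> x\<^sub>0 = E[r\<^sub>N\<^sub>+\<^sub>1' x(N + 1)] = 0\<close>.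
  Taking \<open>N\<close> beyond the horizons needed for the unit vectors \<open>x\<^sub>0\<close> gives \<open>y = 0\<close>.
\<close>

section \<open>Products and sums of square integrable functions\<close>

lemma integrable_mult_of_square_integrable:
  fixes f g :: "'a \<Rightarrow> real"
  assumes "f \<in> borel_measurable P" "g \<in> borel_measurable P"
    and "integrable P (\<lambda>\<omega>. (f \<omega>)\<^sup>2)" "integrable P (\<lambda>\<omega>. (g \<omega>)\<^sup>2)"
  shows "integrable P (\<lambda>\<omega>. f \<omega> * g \<omega>)"
proof (rule Bochner_Integration.integrable_bound)
  show "integrable P (\<lambda>\<omega>. (f \<omega>)\<^sup>2 + (g \<omega>)\<^sup>2)"
    using assms by simp
  show "(\<lambda>\<omega>. f \<omega> * g \<omega>) \<in> borel_measurable P"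
    using assms by measurable
  have "\<bar>x * y\<bar> \<le> x\<^sup>2 + y\<^sup>2" for x y :: real
    using sum_squares_bound[of "\<bar>x\<bar>" "\<bar>y\<bar>"] mult_nonneg_nonneg[OF abs_ge_zero[of x] abs_ge_zero[of y]]
    unfolding abs_mult power2_abs by linarith
  then show "AE \<omega> in P. norm (f \<omega> * g \<omega>) \<le> norm ((f \<omega>)\<^sup>2 + (g \<omega>)\<^sup>2)"
    by simp
qed

lemma square_integrable_add:
  fixes f g :: "'a \<Rightarrow> real"
  assumes "f \<in> borel_measurable P" "g \<in> borel_measurable P"
    and "integrable P (\<lambda>\<omega>. (f \<omega>)\<^sup>2)" "integrable P (\<lambda>\<omega>. (g \<omega>)\<^sup>2)"
  shows "integrable P (\<lambda>\<omega>. (f \<omega> + g \<omega>)\<^sup>2)"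
  using assms integrable_mult_of_square_integrable[OF assms]
  by (simp add: power2_sum mult.assoc)

section \<open>The noise, its filtration, and independence of the past\<close>

locale noise = prob_space P for P :: "'a measure" +
  fixes w :: "nat \<Rightarrow> 'a \<Rightarrow> real"
  assumes noise: "standard_noise P w"
begin

lemma w_measurable [measurable]: "w k \<in> borel_measurable P"
  and w_indep: "indep_vars (\<lambda>_. borel) w UNIV"
  and w_integrable: "integrable P (w k)" "integrable P (\<lambda>\<omega>. (w k \<omega>)\<^sup>2)"
  and w_mean: "expectation (w k) = 0"
  and w_variance: "expectation (\<lambda>\<omega>. (w k \<omega>)\<^sup>2) = 1"
  using noise by (auto simp: standard_noise_def)

lemma space_past [simp]: "space (past P w k) = space P"
  unfolding past_def by (rule space_measure_of) auto

text \<open>Splitting the generators by time index gives the union that the grouping rule for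
  independent families in \<open>indep_past\<close> works with.\<close>

lemma sets_past:
  "sets (past P w k) = sigma_sets (space P) (\<Union>j<k. {w j -` S \<inter> space P | S. S \<in> sets borel})"
  unfolding past_def by (subst sets_measure_of) (auto intro!: arg_cong[where f = "sigma_sets _"])

lemma sets_past_subset: "sets (past P w k) \<subseteq> sets P"
  unfolding sets_past
  by (rule sets.sigma_sets_subset) (auto intro: measurable_sets[OF w_measurable])

lemma past_measurable: "f \<in> borel_measurable (past P w k) \<Longrightarrow> f \<in> borel_measurable P"
  using measurable_mono[OF order_refl refl sets_past_subset space_past] by blast

lemma sets_past_mono: "i \<le> j \<Longrightarrow> sets (past P w i) \<subseteq> sets (past P w j)"
  unfolding sets_past by (rule sigma_sets_mono') force

lemma past_measurable_mono:
  "f \<in> borel_measurable (past P w i) \<Longrightarrow> i \<le> j \<Longrightarrow> f \<in> borel_measurable (past P w j)"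
  using measurable_mono[OF order_refl refl sets_past_mono, of i j borel] by auto

lemma w_past_measurable: "w k \<in> borel_measurable (past P w (Suc k))"
proof (rule measurableI)
  fix S :: "real set" assume "S \<in> sets borel"
  then show "w k -` S \<inter> space (past P w (Suc k)) \<in> sets (past P w (Suc k))"
    unfolding sets_past by (auto intro!: sigma_sets.Basic)
qed simp

text \<open>The generators at times below \<open>k\<close> and the one at time \<open>k\<close> have
  disjoint index sets and are stable under intersection, so the two generated \<sigma>-algebras
  inherit independence from the family \<open>w\<close>. The function \<open>f\<close> is known only
  through its measurability, which is why the argument is carried out on \<sigma>-algebras.\<close>

lemma indep_past:
  assumes f: "f \<in> borel_measurable (past P w k)"
  shows "indep_var borel f borel (w k)"
  unfolding indep_var_def indep_vars_def2
proof (intro conjI ballI)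
  fix b :: bool
  show "random_variable (case b of True \<Rightarrow> borel | False \<Rightarrow> borel)
          (case b of True \<Rightarrow> f | False \<Rightarrow> w k)"
    using past_measurable[OF f] by (cases b) auto
next
  let ?E = "\<lambda>j. {w j -` S \<inter> space P | S. S \<in> sets borel}"
  have "indep_sets (\<lambda>b. sigma_sets (space P) (\<Union>j\<in>(case b of True \<Rightarrow> {..<k} | False \<Rightarrow> {k}). ?E j)) UNIV"
  proof (rule indep_sets_collect_sigma)
    show "indep_sets ?E (\<Union>b\<in>UNIV. case b of True \<Rightarrow> {..<k} | False \<Rightarrow> {k})"
      using w_indep unfolding indep_vars_def2 by (auto intro: indep_sets_mono_index)
    show "disjoint_family (case_bool {..<k} {k})"
      by (auto simp: disjoint_family_on_def split: bool.split)
    show "Int_stable (?E j)" for j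
      by (fastforce simp: Int_stable_def intro: exI[where x = "_ \<inter> _"])
  qed
  \<comment> \<open>Independence passes to smaller families: preimages under \<open>f\<close> lie in
    the past, preimages under \<open>w k\<close> among the generators at time
    \<open>k\<close>.\<close>
  then show "indep_sets (\<lambda>b. {(case b of True \<Rightarrow> f | False \<Rightarrow> w k) -` A \<inter> space P | A.
      A \<in> sets (case b of True \<Rightarrow> borel | False \<Rightarrow> borel)}) UNIV"
  proof (rule indep_sets_mono_sets)
    fix b :: bool
    show "{(case b of True \<Rightarrow> f | False \<Rightarrow> w k) -` A \<inter> space P | A.
        A \<in> sets (case b of True \<Rightarrow> borel | False \<Rightarrow> borel)}
      \<subseteq> sigma_sets (space P) (\<Union>j\<in>(case b of True \<Rightarrow> {..<k} | False \<Rightarrow> {k}). ?E j)"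
    proof (cases b)
      case True
      then show ?thesis
        using measurable_sets[OF f] by (auto simp: sets_past)
    qed (auto intro!: sigma_sets.Basic)
  qed
qed

text \<open>Independence factors the expectation, and the mean of \<open>w k\<close> is zero. This
  removes the cross terms in \<open>expectation_affine_scalar_prod\<close>.\<close>

lemma past_times_w:
  assumes f: "f \<in> borel_measurable (past P w k)" and int: "integrable P f"
  shows "integrable P (\<lambda>\<omega>. f \<omega> * w k \<omega>)" and "expectation (\<lambda>\<omega>. f \<omega> * w k \<omega>) = 0"
  using indep_var_integrable[OF indep_past[OF f] int w_integrable(1)]
    indep_var_lebesgue_integral[OF indep_past[OF f] int w_integrable(1)] w_mean by auto

text \<open>Squaring \<open>w k\<close> preserves its independence of \<open>f\<close>, and the
  second factor of the expectation is the variance 1.\<close>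

lemma past_times_w_square:
  assumes f: "f \<in> borel_measurable (past P w k)" and int: "integrable P f"
  shows "integrable P (\<lambda>\<omega>. f \<omega> * (w k \<omega>)\<^sup>2)"
    and "expectation (\<lambda>\<omega>. f \<omega> * (w k \<omega>)\<^sup>2) = expectation f"
proof -
  have "indep_var borel ((\<lambda>x. x) \<circ> f) borel ((\<lambda>x. x\<^sup>2) \<circ> w k)"
    by (rule indep_var_compose[OF indep_past[OF f]]) auto
  then have ind: "indep_var borel f borel (\<lambda>\<omega>. (w k \<omega>)\<^sup>2)"
    by (simp add: o_def)
  show "integrable P (\<lambda>\<omega>. f \<omega> * (w k \<omega>)\<^sup>2)"
    "expectation (\<lambda>\<omega>. f \<omega> * (w k \<omega>)\<^sup>2) = expectation f"
    using indep_var_integrable[OF ind int w_integrable(2)]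
      indep_var_lebesgue_integral[OF ind int w_integrable(2)] w_variance by auto
qed

section \<open>Square integrable adapted scalars and vectors\<close>

definition L2 :: "nat \<Rightarrow> ('a \<Rightarrow> real) set" where
  "L2 k = {f. f \<in> borel_measurable (past P w k) \<and> integrable P (\<lambda>\<omega>. (f \<omega>)\<^sup>2)}"

lemma L2_mult:
  assumes "f \<in> L2 k" "g \<in> L2 k"
  shows "(\<lambda>\<omega>. f \<omega> * g \<omega>) \<in> borel_measurable (past P w k)" "integrable P (\<lambda>\<omega>. f \<omega> * g \<omega>)"
  using assms by (auto simp: L2_def intro!: integrable_mult_of_square_integrable past_measurable)

lemma L2_add: "f \<in> L2 k \<Longrightarrow> g \<in> L2 k \<Longrightarrow> (\<lambda>\<omega>. f \<omega> + g \<omega>) \<in> L2 k"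
  by (auto simp: L2_def intro!: square_integrable_add past_measurable)

lemma L2_const: "(\<lambda>_. c) \<in> L2 k"
  by (simp add: L2_def)

lemma L2_cmult: "f \<in> L2 k \<Longrightarrow> (\<lambda>\<omega>. c * f \<omega>) \<in> L2 k"
  by (auto simp: L2_def power_mult_distrib)

lemma L2_sum: "(\<And>i. i \<in> I \<Longrightarrow> f i \<in> L2 k) \<Longrightarrow> (\<lambda>\<omega>. \<Sum>i\<in>I. f i \<omega>) \<in> L2 k"
  by (induction I rule: infinite_finite_induct) (auto intro: L2_add L2_const[of 0])

lemma L2_Suc: "f \<in> L2 k \<Longrightarrow> f \<in> L2 (Suc k)"
  by (auto simp: L2_def intro: past_measurable_mono)

text \<open>A product of two square integrable functions is in general only integrable; here
  independence makes \<open>f\<^sup>2 * (w k)\<^sup>2\<close> integrable. The index rises by one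
  because \<open>w k\<close> becomes known only at time \<open>Suc k\<close>.\<close>

lemma L2_times_w:
  assumes "f \<in> L2 k"
  shows "(\<lambda>\<omega>. w k \<omega> * f \<omega>) \<in> L2 (Suc k)"
proof -
  have "integrable P (\<lambda>\<omega>. (f \<omega>)\<^sup>2 * (w k \<omega>)\<^sup>2)"
    using assms by (intro past_times_w_square) (auto simp: L2_def)
  moreover have "f \<in> borel_measurable (past P w (Suc k))"
    using L2_Suc[OF assms] by (simp add: L2_def)
  ultimately show ?thesis
    using w_past_measurable by (simp add: L2_def power_mult_distrib mult.commute[of "(f _)\<^sup>2"])
qed

text \<open>A single time slice of \<open>l2_adapted\<close>, so that closure properties can be
  proved one time at a time, coordinate by coordinate.\<close>

definition L2v :: "nat \<Rightarrow> nat \<Rightarrow> ('a \<Rightarrow> real Matrix.vec) set" where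
  "L2v k s = {q. (\<forall>\<omega>\<in>space P. q \<omega> \<in> carrier_vec s) \<and> (\<forall>i<s. (\<lambda>\<omega>. q \<omega> $ i) \<in> L2 k)}"

lemma l2_adapted_iff: "q \<in> l2_adapted P w N s \<longleftrightarrow> (\<forall>k\<le>N. q k \<in> L2v k s)"
  by (simp add: l2_adapted_def L2v_def L2_def Ball_def)

lemma L2v_carrier: "q \<in> L2v k s \<Longrightarrow> \<omega> \<in> space P \<Longrightarrow> q \<omega> \<in> carrier_vec s"
  by (simp add: L2v_def)

lemma L2v_coordinate: "q \<in> L2v k s \<Longrightarrow> i < s \<Longrightarrow> (\<lambda>\<omega>. q \<omega> $ i) \<in> L2 k"
  by (simp add: L2v_def)

text \<open>Coordinates of vector expressions agree with scalar formulas only where the dimensions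
  are known, that is, on \<open>space P\<close>.\<close>

lemma L2_cong: "(\<And>\<omega>. \<omega> \<in> space P \<Longrightarrow> f \<omega> = g \<omega>) \<Longrightarrow> f \<in> L2 k \<longleftrightarrow> g \<in> L2 k"
  unfolding L2_def mem_Collect_eq
  by (intro conj_cong measurable_cong Bochner_Integration.integrable_cong) auto

lemma L2v_const: "c \<in> carrier_vec s \<Longrightarrow> (\<lambda>_. c) \<in> L2v k s"
  by (simp add: L2v_def L2_const)

lemma L2v_Suc: "q \<in> L2v k s \<Longrightarrow> q \<in> L2v (Suc k) s"
  by (simp add: L2v_def L2_Suc)

lemma L2v_add:
  assumes q: "q \<in> L2v k s" and r: "r \<in> L2v k s"
  shows "(\<lambda>\<omega>. q \<omega> + r \<omega>) \<in> L2v k s"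
proof -
  have "(\<lambda>\<omega>. (q \<omega> + r \<omega>) $ i) \<in> L2 k" if "i < s" for i
    using L2_add[OF L2v_coordinate[OF q that] L2v_coordinate[OF r that]]
    by (rule L2_cong[THEN iffD2, rotated]) (use carrier_vecD[OF L2v_carrier[OF r]] that in simp)
  then show ?thesis using q r by (auto simp: L2v_def)
qed

lemma L2v_mult_mat:
  assumes X: "X \<in> carrier_mat t s" and q: "q \<in> L2v k s"
  shows "(\<lambda>\<omega>. X *\<^sub>v q \<omega>) \<in> L2v k t"
proof -
  have "(\<lambda>\<omega>. (X *\<^sub>v q \<omega>) $ i) \<in> L2 k" if "i < t" for i
  proof (rule L2_cong[THEN iffD2])
    show "(\<lambda>\<omega>. \<Sum>j<s. X $$ (i, j) * q \<omega> $ j) \<in> L2 k"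
      by (intro L2_sum L2_cmult L2v_coordinate[OF q]) simp
    fix \<omega> assume "\<omega> \<in> space P"
    then show "(X *\<^sub>v q \<omega>) $ i = (\<Sum>j<s. X $$ (i, j) * q \<omega> $ j)"
      using X that L2v_carrier[OF q]
      by (auto simp: scalar_prod_def atLeast0LessThan intro!: sum.cong)
  qed
  then show ?thesis using X q by (auto simp: L2v_def)
qed

lemma L2v_times_w:
  assumes q: "q \<in> L2v k s"
  shows "(\<lambda>\<omega>. w k \<omega> \<cdot>\<^sub>v q \<omega>) \<in> L2v (Suc k) s"
proof -
  have "(\<lambda>\<omega>. (w k \<omega> \<cdot>\<^sub>v q \<omega>) $ i) \<in> L2 (Suc k)" if "i < s" for i
    using L2_times_w[OF L2v_coordinate[OF q that]]
    by (rule L2_cong[THEN iffD2, rotated]) (use carrier_vecD[OF L2v_carrier[OF q]] that in simp)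
  then show ?thesis using q by (auto simp: L2v_def)
qed

lemma L2v_scalar_prod:
  assumes q: "q \<in> L2v k s" and r: "r \<in> L2v k s"
  shows "(\<lambda>\<omega>. q \<omega> \<bullet> r \<omega>) \<in> borel_measurable (past P w k)" (is ?meas)
    and "integrable P (\<lambda>\<omega>. q \<omega> \<bullet> r \<omega>)" (is ?int)
proof -
  have eq: "q \<omega> \<bullet> r \<omega> = (\<Sum>i<s. q \<omega> $ i * r \<omega> $ i)" if "\<omega> \<in> space P" for \<omega>
    using L2v_carrier[OF r that] by (auto simp: scalar_prod_def atLeast0LessThan)
  note m = L2_mult[OF L2v_coordinate[OF q] L2v_coordinate[OF r]]
  show ?meas
    using m(1) by (subst measurable_cong[OF eq]) auto
  show ?int
    using m(2) by (subst Bochner_Integration.integrable_cong[OF refl eq]) auto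
qed

text \<open>Of the four terms of the expanded product, the two linear in \<open>w k\<close> have
  expectation zero and the quadratic one loses its factor by unit variance. Both the moment
  recursion and the duality step reduce to this identity.\<close>

lemma expectation_affine_scalar_prod:
  assumes r: "r \<in> L2v k s" and r': "r' \<in> L2v k s" and a: "a \<in> L2v k s" and a': "a' \<in> L2v k s"
  shows "expectation (\<lambda>\<omega>. (r \<omega> + w k \<omega> \<cdot>\<^sub>v r' \<omega>) \<bullet> (a \<omega> + w k \<omega> \<cdot>\<^sub>v a' \<omega>)) =
    expectation (\<lambda>\<omega>. r \<omega> \<bullet> a \<omega>) + expectation (\<lambda>\<omega>. r' \<omega> \<bullet> a' \<omega>)"
proof -
  let ?e = "\<lambda>\<omega>. r \<omega> \<bullet> a \<omega> + (r \<omega> \<bullet> a' \<omega>) * w k \<omega> + (r' \<omega> \<bullet> a \<omega>) * w k \<omega>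
    + (r' \<omega> \<bullet> a' \<omega>) * (w k \<omega>)\<^sup>2"
  have "expectation (\<lambda>\<omega>. (r \<omega> + w k \<omega> \<cdot>\<^sub>v r' \<omega>) \<bullet> (a \<omega> + w k \<omega> \<cdot>\<^sub>v a' \<omega>)) = expectation ?e"
  proof (rule Bochner_Integration.integral_cong[OF refl])
    fix \<omega> assume "\<omega> \<in> space P"
    then have c: "r \<omega> \<in> carrier_vec s" "r' \<omega> \<in> carrier_vec s"
      "a \<omega> \<in> carrier_vec s" "a' \<omega> \<in> carrier_vec s"
      using assms[THEN L2v_carrier] by simp_all
    then show "(r \<omega> + w k \<omega> \<cdot>\<^sub>v r' \<omega>) \<bullet> (a \<omega> + w k \<omega> \<cdot>\<^sub>v a' \<omega>) = ?e \<omega>"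
      by (simp add: add_scalar_prod_distrib[of _ s] scalar_prod_add_distrib[of _ s]
          algebra_simps power2_eq_square)
  qed
  also have "\<dots> = expectation (\<lambda>\<omega>. r \<omega> \<bullet> a \<omega>) + expectation (\<lambda>\<omega>. r' \<omega> \<bullet> a' \<omega>)"
    using L2v_scalar_prod[OF r a] past_times_w[OF L2v_scalar_prod[OF r a']]
      past_times_w[OF L2v_scalar_prod[OF r' a]] past_times_w_square[OF L2v_scalar_prod[OF r' a']]
    by simp
  finally show ?thesis .
qed

end

section \<open>Matrix entries, invertibility and ordered products\<close>

lemma mat_index_as_scalar_prod:
  fixes X :: "'a :: comm_semiring_1 mat"
  assumes "X \<in> carrier_mat n n" "a < n" "b < n"
  shows "X $$ (a, b) = unit_vec n a \<bullet> (X *\<^sub>v unit_vec n b)"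
  using assms by (simp add: scalar_prod_left_unit[of _ n])

lemma smult_mat_mult_vec:
  fixes X :: "'a :: comm_semiring_0 mat"
  assumes "X \<in> carrier_mat nr nc" "v \<in> carrier_vec nc"
  shows "(c \<cdot>\<^sub>m X) *\<^sub>v v = c \<cdot>\<^sub>v (X *\<^sub>v v)"
  using assms by (intro eq_vecI) (auto simp: smult_scalar_prod_distrib[of _ nc])

text \<open>A trivial kernel forces a nonzero determinant, and a matrix with nonzero determinant is
  a unit of the ring of square matrices.\<close>

lemma invertible_mat_iff_kernel:
  fixes X :: "'a :: field mat"
  assumes X: "X \<in> carrier_mat n n"
  shows "invertible_mat X \<longleftrightarrow> (\<forall>y\<in>carrier_vec n. X *\<^sub>v y = 0\<^sub>v n \<longrightarrow> y = 0\<^sub>v n)"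
proof
  assume "invertible_mat X"
  then obtain Y where Y: "inverts_mat X Y" "inverts_mat Y X"
    by (auto simp: invertible_mat_def)
  have YX: "Y * X = 1\<^sub>m (dim_row Y)" and XY: "X * Y = 1\<^sub>m n"
    using Y X by (auto simp: inverts_mat_def)
  \<comment> \<open>\<open>inverts_mat\<close> does not prescribe the shape of \<open>Y\<close>; the
    column counts of the two identities do.\<close>
  from arg_cong[OF YX, of dim_col] arg_cong[OF XY, of dim_col]
  have Yc: "Y \<in> carrier_mat n n" using X by auto
  show "\<forall>y\<in>carrier_vec n. X *\<^sub>v y = 0\<^sub>v n \<longrightarrow> y = 0\<^sub>v n"
  proof (intro ballI impI)
    fix y assume y: "y \<in> carrier_vec n" "X *\<^sub>v y = 0\<^sub>v n"
    have "y = (Y * X) *\<^sub>v y" using YX Yc y by simp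
    also have "\<dots> = Y *\<^sub>v (X *\<^sub>v y)" using X Yc y(1) by simp
    also have "\<dots> = 0\<^sub>v n" using y(2) Yc by auto
    finally show "y = 0\<^sub>v n" .
  qed
next
  assume "\<forall>y\<in>carrier_vec n. X *\<^sub>v y = 0\<^sub>v n \<longrightarrow> y = 0\<^sub>v n"
  then have "det X \<noteq> 0"
    using det_0_iff_vec_prod_zero_field[OF X] by auto
  then have "X \<in> Units (ring_mat TYPE('a) n ())"
    by (rule det_non_zero_imp_unit[OF X])
  then show "invertible_mat X"
    using X unfolding Units_def invertible_mat_def inverts_mat_def
    by (auto simp: ring_mat_simps)
qed

lemma invertible_mat_surj:
  fixes X :: "'a :: semiring_1 mat"
  assumes X: "X \<in> carrier_mat n n" and inv: "invertible_mat X" and x: "x \<in> carrier_vec n"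
  obtains y where "y \<in> carrier_vec n" "X *\<^sub>v y = x"
proof -
  from inv obtain Y where Y: "inverts_mat X Y" "inverts_mat Y X"
    by (auto simp: invertible_mat_def)
  have YX: "Y * X = 1\<^sub>m (dim_row Y)" and XY: "X * Y = 1\<^sub>m n"
    using Y X by (auto simp: inverts_mat_def)
  from arg_cong[OF YX, of dim_col] arg_cong[OF XY, of dim_col]
  have Yc: "Y \<in> carrier_mat n n" using X by auto
  have "X *\<^sub>v (Y *\<^sub>v x) = (X * Y) *\<^sub>v x" using X Yc x by simp
  also have "\<dots> = x" using XY x by simp
  finally show ?thesis using that[of "Y *\<^sub>v x"] Yc x by simp
qed

lemma mat_prod_list_carrier:
  "set Xs \<subseteq> carrier_mat n n \<Longrightarrow> mat_prod_list n Xs \<in> carrier_mat n n"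
  by (induction Xs) (auto simp: mat_prod_list_def intro!: mult_carrier_mat[of _ n n])

text \<open>The product is a fold that peels off the first factor, whereas induction over time
  appends a factor at the end.\<close>

lemma mat_prod_list_snoc:
  assumes "set Xs \<subseteq> carrier_mat n n" and "Y \<in> carrier_mat n n"
  shows "mat_prod_list n (Xs @ [Y]) = mat_prod_list n Xs * Y"
  using assms(1)
proof (induction Xs)
  case Nil
  then show ?case using assms(2) by (simp add: mat_prod_list_def)
next
  case (Cons X Xs)
  have "mat_prod_list n (X # Xs @ [Y]) = X * mat_prod_list n (Xs @ [Y])"
    by (simp add: mat_prod_list_def)
  also have "\<dots> = X * (mat_prod_list n Xs * Y)" using Cons by simp
  also have "\<dots> = X * mat_prod_list n Xs * Y"
    using Cons.prems assms(2) mat_prod_list_carrier[of Xs n]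
    by (intro assoc_mult_mat[symmetric, of _ n n _ n _ n]) auto
  finally show ?case by (simp add: mat_prod_list_def)
qed

text \<open>Transposition reverses the order of factors, so the right-hand product in
  \<open>gramian_integrand\<close> is the transpose of the left-hand one.\<close>

lemma mat_prod_list_transpose:
  assumes "set Xs \<subseteq> carrier_mat n n"
  shows "mat_prod_list n (map transpose_mat (rev Xs)) = (mat_prod_list n Xs)\<^sup>T"
  using assms
proof (induction Xs)
  case Nil
  then show ?case by (simp add: mat_prod_list_def)
next
  case (Cons X Xs)
  have "mat_prod_list n (map transpose_mat (rev (X # Xs)))
      = mat_prod_list n (map transpose_mat (rev Xs)) * X\<^sup>T"
    using mat_prod_list_snoc[of "map transpose_mat (rev Xs)" n "X\<^sup>T"] Cons.prems
    by (simp add: image_subset_iff subsetD)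
  also have "\<dots> = (mat_prod_list n Xs)\<^sup>T * X\<^sup>T" using Cons by simp
  also have "\<dots> = (X * mat_prod_list n Xs)\<^sup>T"
    using Cons.prems by (subst transpose_mult[of _ n n _ n]) (auto intro: mat_prod_list_carrier)
  finally show ?case by (simp add: mat_prod_list_def)
qed

section \<open>The adjoint state and the propagation of its second moments\<close>

locale backward_system = noise +
  fixes n p :: nat and C Cbar D K :: "real mat"
  assumes carrier [simp]: "C \<in> carrier_mat n n" "Cbar \<in> carrier_mat n n" "D \<in> carrier_mat n p"
      "K \<in> carrier_mat n n"
    and inverse: "C * K = 1\<^sub>m n" "K * C = 1\<^sub>m n"
begin

lemma mult_carrier_square [simp]:
  "X \<in> carrier_mat n n \<Longrightarrow> Y \<in> carrier_mat n n \<Longrightarrow> X * Y \<in> carrier_mat n n"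
  by (rule mult_carrier_mat)

lemma mult_vec_carrier [simp]:
  "X \<in> carrier_mat n n \<Longrightarrow> y \<in> carrier_vec n \<Longrightarrow> X *\<^sub>v y \<in> carrier_vec n"
  by (rule mult_mat_vec_carrier)

primrec adjoint_state :: "real Matrix.vec \<Rightarrow> nat \<Rightarrow> 'a \<Rightarrow> real Matrix.vec" where
  "adjoint_state y 0 = (\<lambda>_. y)"
| "adjoint_state y (Suc k) = (\<lambda>\<omega>. C\<^sup>T *\<^sub>v adjoint_state y k \<omega> +
     w k \<omega> \<cdot>\<^sub>v (Cbar\<^sup>T *\<^sub>v adjoint_state y k \<omega>))"

lemma adjoint_state_carrier [simp]: "y \<in> carrier_vec n \<Longrightarrow> adjoint_state y k \<omega> \<in> carrier_vec n"
  by (induction k) auto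

lemma adjoint_state_L2v: "y \<in> carrier_vec n \<Longrightarrow> adjoint_state y k \<in> L2v k n"
proof (induction k)
  case (Suc k)
  then show ?case
    by (auto intro!: L2v_add L2v_times_w L2v_mult_mat[of _ n n] intro: L2v_Suc[of _ k])
qed (simp add: L2v_const)

definition moment_step :: "real mat \<Rightarrow> real mat" where
  "moment_step X = C * X * C\<^sup>T + Cbar * X * Cbar\<^sup>T"

lemma moment_step_carrier [simp]: "X \<in> carrier_mat n n \<Longrightarrow> moment_step X \<in> carrier_mat n n"
  by (auto simp: moment_step_def)

lemma moment_power_carrier [simp]:
  "X \<in> carrier_mat n n \<Longrightarrow> (moment_step ^^ i) X \<in> carrier_mat n n"
  by (induction i) auto

lemma moment_step_mult_vec:
  assumes "X \<in> carrier_mat n n" "y \<in> carrier_vec n"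
  shows "moment_step X *\<^sub>v y = C *\<^sub>v (X *\<^sub>v (C\<^sup>T *\<^sub>v y)) + Cbar *\<^sub>v (X *\<^sub>v (Cbar\<^sup>T *\<^sub>v y))"
proof -
  have *: "(Y * X * Y\<^sup>T) *\<^sub>v y = Y *\<^sub>v (X *\<^sub>v (Y\<^sup>T *\<^sub>v y))" if "Y \<in> carrier_mat n n" for Y
    using assms that by (simp add: assoc_mult_mat_vec[of _ n n _ n] del: assoc_mult_mat)
  from *[OF carrier(1)] *[OF carrier(2)] show ?thesis
    unfolding moment_step_def using assms
    by (simp add: add_mult_distrib_mat_vec[of _ n n] del: assoc_mult_mat)
qed

lemma moment_step_add:
  assumes "X \<in> carrier_mat n n" "Y \<in> carrier_mat n n"
  shows "moment_step (X + Y) = moment_step X + moment_step Y"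
proof -
  have *: "Z * (X + Y) * Z\<^sup>T = Z * X * Z\<^sup>T + Z * Y * Z\<^sup>T" if "Z \<in> carrier_mat n n" for Z
    using assms that
    by (simp add: mult_add_distrib_mat[of _ n n _ n] add_mult_distrib_mat[of _ n n _ _ n])
  have swap: "S + T + (U + V) = S + U + (T + V)"
    if "S \<in> carrier_mat n n" "T \<in> carrier_mat n n" "U \<in> carrier_mat n n" "V \<in> carrier_mat n n"
    for S T U V :: "real mat"
    using that by (intro eq_matI) auto
  show ?thesis
    unfolding moment_step_def *[OF carrier(1)] *[OF carrier(2)]
    using assms by (intro swap) auto
qed

text \<open>Averaging over the newest noise \<open>w k\<close> replaces the weight \<open>X\<close>
  by \<open>moment_step X\<close> and leaves a form in the states at time \<open>k\<close>, hence
  the induction with arbitrary \<open>X\<close>. Two starting vectors are allowed because the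
  entries of the Gramian need distinct unit vectors, while the kernel argument takes them
  equal.\<close>

lemma expectation_adjoint_form:
  assumes "X \<in> carrier_mat n n" and y: "y \<in> carrier_vec n" and u: "u \<in> carrier_vec n"
  shows "expectation (\<lambda>\<omega>. adjoint_state y k \<omega> \<bullet> (X *\<^sub>v adjoint_state u k \<omega>)) =
    y \<bullet> ((moment_step ^^ k) X *\<^sub>v u)"
  using assms(1)
proof (induction k arbitrary: X)
  case 0
  then show ?case by (simp add: prob_space)
next
  case (Suc k)
  note X = Suc.prems
  let ?r = "adjoint_state y k" and ?s = "adjoint_state u k"
  have [simp]: "?r \<omega> \<in> carrier_vec n" "?s \<omega> \<in> carrier_vec n" for \<omega>
    using y u by simp_all
  have rL: "?r \<in> L2v k n" and sL: "?s \<in> L2v k n"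
    using y u by (simp_all add: adjoint_state_L2v)
  have mL: "(\<lambda>\<omega>. Y *\<^sub>v q \<omega>) \<in> L2v k n" if "Y \<in> carrier_mat n n" "q \<in> L2v k n" for Y q
    using L2v_mult_mat[OF that] .
  have "expectation (\<lambda>\<omega>. adjoint_state y (Suc k) \<omega> \<bullet> (X *\<^sub>v adjoint_state u (Suc k) \<omega>)) =
    expectation (\<lambda>\<omega>. (C\<^sup>T *\<^sub>v ?r \<omega> + w k \<omega> \<cdot>\<^sub>v (Cbar\<^sup>T *\<^sub>v ?r \<omega>)) \<bullet>
      (X *\<^sub>v (C\<^sup>T *\<^sub>v ?s \<omega>) + w k \<omega> \<cdot>\<^sub>v (X *\<^sub>v (Cbar\<^sup>T *\<^sub>v ?s \<omega>))))"
    using X by (simp add: mult_add_distrib_mat_vec[of _ n n] mult_mat_vec[of _ n n])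
  also have "\<dots> = expectation (\<lambda>\<omega>. (C\<^sup>T *\<^sub>v ?r \<omega>) \<bullet> (X *\<^sub>v (C\<^sup>T *\<^sub>v ?s \<omega>))) +
      expectation (\<lambda>\<omega>. (Cbar\<^sup>T *\<^sub>v ?r \<omega>) \<bullet> (X *\<^sub>v (Cbar\<^sup>T *\<^sub>v ?s \<omega>)))"
    using X rL sL by (intro expectation_affine_scalar_prod[where s = n] mL) auto
  also have "\<dots> = expectation (\<lambda>\<omega>. (C\<^sup>T *\<^sub>v ?r \<omega>) \<bullet> (X *\<^sub>v (C\<^sup>T *\<^sub>v ?s \<omega>)) +
      (Cbar\<^sup>T *\<^sub>v ?r \<omega>) \<bullet> (X *\<^sub>v (Cbar\<^sup>T *\<^sub>v ?s \<omega>)))"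
    using X rL sL
    by (intro Bochner_Integration.integral_add[symmetric] L2v_scalar_prod(2)[where s = n and k = k] mL)
      auto
  \<comment> \<open>Moving the transposed factors across the scalar product assembles
    \<open>moment_step X\<close>.\<close>
  also have "\<dots> = expectation (\<lambda>\<omega>. ?r \<omega> \<bullet> (moment_step X *\<^sub>v ?s \<omega>))"
    using X by (simp add: moment_step_mult_vec scalar_prod_add_distrib[of _ n]
        transpose_vec_mult_scalar[of _ n n])
  also have "\<dots> = y \<bullet> ((moment_step ^^ k) (moment_step X) *\<^sub>v u)"
    using Suc.IH[of "moment_step X"] X by simp
  finally show ?case by (simp add: funpow_swap1)
qed

section \<open>The Gramian as a deterministic recursion\<close>

primrec step_gramian :: "nat \<Rightarrow> real mat" where
  "step_gramian 0 = 0\<^sub>m n n"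
| "step_gramian (Suc j) = D * D\<^sup>T + moment_step (step_gramian j)"

lemma DDT_carrier [simp]: "D * D\<^sup>T \<in> carrier_mat n n"
  by (simp add: mult_carrier_mat[of _ n p])

lemma step_gramian_carrier [simp]: "step_gramian j \<in> carrier_mat n n"
  by (induction j) auto

text \<open>The definition applies \<open>moment_step\<close> to a whole partial sum, in the manner
  of Horner; additivity of \<open>moment_step\<close> turns this into the addition of one new power.
  The recursive form serves the control construction, the additive one the comparison with the
  Gramian.\<close>

lemma step_gramian_Suc: "step_gramian (Suc j) = step_gramian j + (moment_step ^^ j) (D * D\<^sup>T)"
proof (induction j)
  case 0
  have "moment_step (0\<^sub>m n n) = 0\<^sub>m n n"
    by (simp add: moment_step_def left_mult_zero_mat[of _ n n] right_mult_zero_mat[of _ n n])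
  then show ?case
    using DDT_carrier by (simp del: DDT_carrier)
next
  case (Suc j)
  have "step_gramian (Suc (Suc j)) = D * D\<^sup>T + moment_step (step_gramian j + (moment_step ^^ j) (D * D\<^sup>T))"
    using Suc by simp
  also have "\<dots> = D * D\<^sup>T + (moment_step (step_gramian j) + moment_step ((moment_step ^^ j) (D * D\<^sup>T)))"
    by (subst moment_step_add) auto
  also have "\<dots> = step_gramian (Suc j) + (moment_step ^^ Suc j) (D * D\<^sup>T)"
    by (simp add: assoc_add_mat[of _ n n])
  finally show ?case .
qed

text \<open>Summing scalars covers both uses: unit vectors give the entries, and
  \<open>u = y\<close> gives the quadratic form.\<close>

lemma step_gramian_form:
  assumes "y \<in> carrier_vec n" "u \<in> carrier_vec n"
  shows "y \<bullet> (step_gramian j *\<^sub>v u) = (\<Sum>i<j. y \<bullet> ((moment_step ^^ i) (D * D\<^sup>T) *\<^sub>v u))"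
proof (induction j)
  case 0
  have "0\<^sub>m n n *\<^sub>v u = 0\<^sub>v n" using assms by (intro eq_vecI) auto
  then show ?case using assms by simp
next
  case (Suc j)
  have "step_gramian (Suc j) *\<^sub>v u = step_gramian j *\<^sub>v u + (moment_step ^^ j) (D * D\<^sup>T) *\<^sub>v u"
    unfolding step_gramian_Suc using assms by (subst add_mult_distrib_mat_vec[of _ n n]) auto
  then show ?case
    using Suc assms by (simp add: scalar_prod_add_distrib[of _ n] del: step_gramian.simps)
qed

lemma noise_mat_carrier [simp]: "noise_mat w C Cbar k \<omega> \<in> carrier_mat n n"
  by (simp add: noise_mat_def)

text \<open>A factor appended on the right of the product becomes the leftmost one after
  transposition, which is one step of the adjoint recursion.\<close>

lemma adjoint_state_eq:
  assumes "y \<in> carrier_vec n"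
  shows "adjoint_state y i \<omega> =
    (mat_prod_list n (map (\<lambda>k. noise_mat w C Cbar k \<omega>) [0..<i]))\<^sup>T *\<^sub>v y"
proof (induction i)
  case 0
  then show ?case using assms by (simp add: mat_prod_list_def)
next
  case (Suc i)
  let ?Phi = "mat_prod_list n (map (\<lambda>k. noise_mat w C Cbar k \<omega>) [0..<i])"
  have Phi: "?Phi \<in> carrier_mat n n" by (rule mat_prod_list_carrier) auto
  have "(mat_prod_list n (map (\<lambda>k. noise_mat w C Cbar k \<omega>) [0..<Suc i]))\<^sup>T
      = (?Phi * noise_mat w C Cbar i \<omega>)\<^sup>T"
    using mat_prod_list_snoc[of "map (\<lambda>k. noise_mat w C Cbar k \<omega>) [0..<i]" n "noise_mat w C Cbar i \<omega>"]
    by (simp add: image_subset_iff)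
  also have "\<dots> = (noise_mat w C Cbar i \<omega>)\<^sup>T * ?Phi\<^sup>T"
    using Phi by (intro transpose_mult[of _ n n _ n]) auto
  finally have "(mat_prod_list n (map (\<lambda>k. noise_mat w C Cbar k \<omega>) [0..<Suc i]))\<^sup>T *\<^sub>v y
      = (noise_mat w C Cbar i \<omega>)\<^sup>T *\<^sub>v adjoint_state y i \<omega>"
    using Suc Phi assms by (simp add: assoc_mult_mat_vec[of _ n n _ n])
  also have "(noise_mat w C Cbar i \<omega>)\<^sup>T = C\<^sup>T + w i \<omega> \<cdot>\<^sub>m Cbar\<^sup>T"
    using carrier_matD[OF carrier(1)] carrier_matD[OF carrier(2)]
    unfolding noise_mat_def by (intro eq_matI) simp_all
  also have "\<dots> *\<^sub>v adjoint_state y i \<omega> = adjoint_state y (Suc i) \<omega>"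
    using assms by (simp add: add_mult_distrib_mat_vec[of _ n n] smult_mat_mult_vec[of _ n n])
  finally show ?case ..
qed

text \<open>The integrand is \<open>?Phi * (D * D\<^sup>T) * ?Phi\<^sup>T\<close>. Moving the left
  \<open>?Phi\<close> across the scalar product with a unit vector leaves adjoint states started at
  unit vectors on both sides.\<close>

lemma gramian_integrand_index:
  assumes "a < n" "b < n"
  shows "gramian_integrand w n C Cbar D i \<omega> $$ (a, b) =
    adjoint_state (unit_vec n a) i \<omega> \<bullet> (D * D\<^sup>T *\<^sub>v adjoint_state (unit_vec n b) i \<omega>)"
proof -
  let ?Phi = "mat_prod_list n (map (\<lambda>k. noise_mat w C Cbar k \<omega>) [0..<i])"
  have Phi: "?Phi \<in> carrier_mat n n" by (rule mat_prod_list_carrier) auto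
  have "mat_prod_list n (map (\<lambda>k. (noise_mat w C Cbar k \<omega>)\<^sup>T) (rev [0..<i])) = ?Phi\<^sup>T"
    using mat_prod_list_transpose[of "map (\<lambda>k. noise_mat w C Cbar k \<omega>) [0..<i]" n]
    by (simp add: rev_map o_def image_subset_iff)
  then have "gramian_integrand w n C Cbar D i \<omega> = ?Phi * (D * D\<^sup>T) * ?Phi\<^sup>T"
    by (simp add: gramian_integrand_def)
  moreover have "?Phi * (D * D\<^sup>T) * ?Phi\<^sup>T \<in> carrier_mat n n"
    by (intro mult_carrier_mat[of _ n n] DDT_carrier Phi) (simp add: Phi)
  ultimately have "gramian_integrand w n C Cbar D i \<omega> $$ (a, b) =
      unit_vec n a \<bullet> (?Phi * (D * D\<^sup>T) * ?Phi\<^sup>T *\<^sub>v unit_vec n b)"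
    using mat_index_as_scalar_prod assms by metis
  also have "?Phi * (D * D\<^sup>T) * ?Phi\<^sup>T *\<^sub>v unit_vec n b
      = ?Phi *\<^sub>v (D * D\<^sup>T *\<^sub>v (?Phi\<^sup>T *\<^sub>v unit_vec n b))"
    using Phi DDT_carrier
    by (simp add: assoc_mult_mat_vec[of _ n n _ n] mult_carrier_mat[of _ n n] del: assoc_mult_mat)
  also have "unit_vec n a \<bullet> (?Phi *\<^sub>v (D * D\<^sup>T *\<^sub>v (?Phi\<^sup>T *\<^sub>v unit_vec n b)))
      = (?Phi\<^sup>T *\<^sub>v unit_vec n a) \<bullet> (D * D\<^sup>T *\<^sub>v (?Phi\<^sup>T *\<^sub>v unit_vec n b))"
    using Phi DDT_carrier
    by (subst transpose_vec_mult_scalar[of _ n n]) (auto intro!: mult_mat_vec_carrier[of _ n n])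
  finally show ?thesis
    by (simp add: adjoint_state_eq)
qed

lemma gramian_eq_step_gramian: "gramian P w n C Cbar D N = step_gramian (Suc N)"
proof (rule eq_matI)
  fix a b assume "a < dim_row (step_gramian (Suc N))" "b < dim_col (step_gramian (Suc N))"
  then have ab: "a < n" "b < n"
    using step_gramian_carrier[of "Suc N"] by (auto simp del: step_gramian.simps)
  then have "gramian P w n C Cbar D N $$ (a, b) = (\<Sum>i=0..N.
      expectation (\<lambda>\<omega>. adjoint_state (unit_vec n a) i \<omega> \<bullet>
        (D * D\<^sup>T *\<^sub>v adjoint_state (unit_vec n b) i \<omega>)))"
    by (simp add: gramian_def expectation_mat_def gramian_integrand_index)
  also have "\<dots> = unit_vec n a \<bullet> (step_gramian (Suc N) *\<^sub>v unit_vec n b)"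
    using ab by (simp add: expectation_adjoint_form step_gramian_form atLeast0AtMost lessThan_Suc_atMost
        del: step_gramian.simps sum.lessThan_Suc)
  also have "\<dots> = step_gramian (Suc N) $$ (a, b)"
    using ab by (simp add: mat_index_as_scalar_prod[OF step_gramian_carrier] del: step_gramian.simps)
  finally show "gramian P w n C Cbar D N $$ (a, b) = step_gramian (Suc N) $$ (a, b)" .
qed (simp_all add: gramian_def carrier_matD[OF step_gramian_carrier] del: step_gramian.simps)

section \<open>Necessity: duality between adjoint states and controlled solutions\<close>

lemma adjoint_duality_step:
  assumes y: "y \<in> carrier_vec n"
    and x: "x \<in> L2v k n" and x': "x' \<in> L2v (Suc k) n" and z: "z \<in> L2v k n" and v: "v \<in> L2v k p"
    and eq: "AE \<omega> in P. x \<omega> = C *\<^sub>v x' \<omega> + Cbar *\<^sub>v z \<omega> + D *\<^sub>v v \<omega> - w k \<omega> \<cdot>\<^sub>v (C *\<^sub>v z \<omega>)"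
  shows "expectation (\<lambda>\<omega>. adjoint_state y (Suc k) \<omega> \<bullet> x' \<omega>) =
    expectation (\<lambda>\<omega>. adjoint_state y k \<omega> \<bullet> x \<omega>) -
    expectation (\<lambda>\<omega>. adjoint_state y k \<omega> \<bullet> (D *\<^sub>v v \<omega>))"
proof -
  let ?r = "adjoint_state y k"
  \<comment> \<open>The equation reads \<open>b = C x' - w(k) C z\<close>, where \<open>b\<close>
    collects the terms known at time \<open>k\<close>. As \<open>K\<close> inverts \<open>C\<close>,
    this gives \<open>x' = a + w(k) z\<close> with \<open>a\<close> and \<open>z\<close> both known
    at time \<open>k\<close>, the shape required by \<open>expectation_affine_scalar_prod\<close>.
    Negated matrices express the differences through the closure rules for sums and matrix
    multiples.\<close>
  define b where "b \<omega> = x \<omega> + ((- Cbar) *\<^sub>v z \<omega> + (- D) *\<^sub>v v \<omega>)" for \<omega>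
  define a where "a \<omega> = K *\<^sub>v b \<omega>" for \<omega>
  have r: "?r \<in> L2v k n" using y by (rule adjoint_state_L2v)
  have r_c: "?r \<omega> \<in> carrier_vec n" for \<omega> using y by simp
  have b: "b \<in> L2v k n"
    unfolding b_def using x z v by (intro L2v_add L2v_mult_mat[of _ n n] L2v_mult_mat[of _ n p]) auto
  have a: "a \<in> L2v k n"
    unfolding a_def using b by (intro L2v_mult_mat) auto
  have Dv: "(\<lambda>\<omega>. D *\<^sub>v v \<omega>) \<in> L2v k n"
    using v by (intro L2v_mult_mat) auto
  have Cr: "(\<lambda>\<omega>. C\<^sup>T *\<^sub>v ?r \<omega>) \<in> L2v k n" "(\<lambda>\<omega>. Cbar\<^sup>T *\<^sub>v ?r \<omega>) \<in> L2v k n"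
    using r by (auto intro!: L2v_mult_mat[of _ n n])
  have "AE \<omega> in P. x' \<omega> = a \<omega> + w k \<omega> \<cdot>\<^sub>v z \<omega>"
    using eq
  proof (rule AE_mp, intro AE_I2 impI)
    fix \<omega> assume \<omega>: "\<omega> \<in> space P"
    have [simp]: "x \<omega> \<in> carrier_vec n" "x' \<omega> \<in> carrier_vec n" "z \<omega> \<in> carrier_vec n"
      "v \<omega> \<in> carrier_vec p"
      using x x' z v \<omega> by (auto intro: L2v_carrier)
    have dims: "dim_vec (x' \<omega>) = n" "dim_vec (z \<omega>) = n" "dim_vec (v \<omega>) = p"
      by (rule carrier_vecD, simp)+
    have [simp]: "D *\<^sub>v v \<omega> \<in> carrier_vec n" by (rule mult_mat_vec_carrier[of _ n p]) auto
    have Kv: "K *\<^sub>v (C *\<^sub>v u) = u" if "u \<in> carrier_vec n" for u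
      using that inverse by (metis assoc_mult_mat_vec carrier(1,4) one_mult_mat_vec)
    have C_add: "C *\<^sub>v x' \<omega> + (- w k \<omega>) \<cdot>\<^sub>v (C *\<^sub>v z \<omega>) = C *\<^sub>v (x' \<omega> + (- w k \<omega>) \<cdot>\<^sub>v z \<omega>)"
      by (simp add: mult_add_distrib_mat_vec[of _ n n] mult_mat_vec[of _ n n])
    assume "x \<omega> = C *\<^sub>v x' \<omega> + Cbar *\<^sub>v z \<omega> + D *\<^sub>v v \<omega> - w k \<omega> \<cdot>\<^sub>v (C *\<^sub>v z \<omega>)"
    then have "b \<omega> = C *\<^sub>v x' \<omega> + (- w k \<omega>) \<cdot>\<^sub>v (C *\<^sub>v z \<omega>)"
      unfolding b_def using dims carrier_matD[OF carrier(1)] carrier_matD[OF carrier(2)] carrier_matD[OF carrier(3)]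
      by (intro eq_vecI) (simp_all del: index_mult_mat_vec)
    then have "a \<omega> = x' \<omega> + (- w k \<omega>) \<cdot>\<^sub>v z \<omega>"
      unfolding a_def C_add using Kv by simp
    then show "x' \<omega> = a \<omega> + w k \<omega> \<cdot>\<^sub>v z \<omega>"
      by (intro eq_vecI) (simp_all add: dims)
  qed
  \<comment> \<open>The splitting of \<open>x'\<close> holds only almost surely, so measurability of
    both integrands is needed to exchange them.\<close>
  then have "expectation (\<lambda>\<omega>. adjoint_state y (Suc k) \<omega> \<bullet> x' \<omega>) =
      expectation (\<lambda>\<omega>. adjoint_state y (Suc k) \<omega> \<bullet> (a \<omega> + w k \<omega> \<cdot>\<^sub>v z \<omega>))"
    using past_measurable[OF L2v_scalar_prod(1)[OF adjoint_state_L2v[OF y] x']]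
      past_measurable[OF L2v_scalar_prod(1)[OF adjoint_state_L2v[OF y]
          L2v_add[OF L2v_Suc[OF a] L2v_times_w[OF z]]]]
    by (intro integral_cong_AE) (auto simp del: adjoint_state.simps)
  also have "\<dots> = expectation (\<lambda>\<omega>. (C\<^sup>T *\<^sub>v ?r \<omega>) \<bullet> a \<omega>) + expectation (\<lambda>\<omega>. (Cbar\<^sup>T *\<^sub>v ?r \<omega>) \<bullet> z \<omega>)"
    unfolding adjoint_state.simps using Cr a z by (rule expectation_affine_scalar_prod)
  also have "\<dots> = expectation (\<lambda>\<omega>. (C\<^sup>T *\<^sub>v ?r \<omega>) \<bullet> a \<omega> + (Cbar\<^sup>T *\<^sub>v ?r \<omega>) \<bullet> z \<omega>)"
    using L2v_scalar_prod(2)[OF Cr(1) a] L2v_scalar_prod(2)[OF Cr(2) z] by simp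
  also have "\<dots> = expectation (\<lambda>\<omega>. ?r \<omega> \<bullet> x \<omega> - ?r \<omega> \<bullet> (D *\<^sub>v v \<omega>))"
  proof (rule Bochner_Integration.integral_cong[OF refl])
    fix \<omega> assume \<omega>: "\<omega> \<in> space P"
    have c: "x \<omega> \<in> carrier_vec n" "z \<omega> \<in> carrier_vec n" "v \<omega> \<in> carrier_vec p" "b \<omega> \<in> carrier_vec n"
      "D *\<^sub>v v \<omega> \<in> carrier_vec n"
      using x z v b Dv \<omega> by (auto intro: L2v_carrier)
    \<comment> \<open>Since \<open>C\<close> undoes \<open>K\<close>, the first product equals
      \<open>?r \<bullet> b\<close>; its part \<open>- ?r \<bullet> (Cbar z)\<close> then cancels
      the second product.\<close>
    have "(C\<^sup>T *\<^sub>v ?r \<omega>) \<bullet> a \<omega> = ?r \<omega> \<bullet> (C *\<^sub>v (K *\<^sub>v b \<omega>))"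
      unfolding a_def using c r_c by (intro transpose_vec_mult_scalar[of _ n n]) auto
    also have "C *\<^sub>v (K *\<^sub>v b \<omega>) = b \<omega>"
      using c inverse by (metis assoc_mult_mat_vec carrier(1,4) one_mult_mat_vec)
    also have "?r \<omega> \<bullet> b \<omega> = ?r \<omega> \<bullet> x \<omega> - ?r \<omega> \<bullet> (Cbar *\<^sub>v z \<omega>) - ?r \<omega> \<bullet> (D *\<^sub>v v \<omega>)"
    proof -
      have "b \<omega> = x \<omega> - Cbar *\<^sub>v z \<omega> - D *\<^sub>v v \<omega>"
        unfolding b_def
        by (intro eq_vecI) (simp_all add: carrier_vecD[OF c(1)] carrier_vecD[OF c(2)]
            carrier_vecD[OF c(3)] carrier_matD[OF carrier(2)] carrier_matD[OF carrier(3)]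
            del: index_mult_mat_vec)
      then show ?thesis
        using c r_c by (simp add: scalar_prod_minus_distrib[of _ n])
    qed
    finally show "(C\<^sup>T *\<^sub>v ?r \<omega>) \<bullet> a \<omega> + (Cbar\<^sup>T *\<^sub>v ?r \<omega>) \<bullet> z \<omega> = ?r \<omega> \<bullet> x \<omega> - ?r \<omega> \<bullet> (D *\<^sub>v v \<omega>)"
      using c r_c by (simp add: transpose_vec_mult_scalar[of _ n n])
  qed
  also have "\<dots> = expectation (\<lambda>\<omega>. ?r \<omega> \<bullet> x \<omega>) - expectation (\<lambda>\<omega>. ?r \<omega> \<bullet> (D *\<^sub>v v \<omega>))"
    using L2v_scalar_prod(2)[OF r x] L2v_scalar_prod(2)[OF r Dv] by simp
  finally show ?thesis .
qed

text \<open>The quadratic form of the Gramian at \<open>y\<close> is the sum of the expected squared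
  lengths of \<open>D\<^sup>T r\<^sub>i\<close>. For \<open>y\<close> in the kernel this sum of
  nonnegative terms is zero, so each \<open>D\<^sup>T r\<^sub>k\<close> with
  \<open>k \<le> N\<close> vanishes almost surely and pairs to zero with any control.\<close>

lemma adjoint_control_orthogonal:
  assumes y: "y \<in> carrier_vec n" and ker: "step_gramian (Suc N) *\<^sub>v y = 0\<^sub>v n"
    and k: "k \<le> N" and v: "v \<in> L2v k p"
  shows "expectation (\<lambda>\<omega>. adjoint_state y k \<omega> \<bullet> (D *\<^sub>v v \<omega>)) = 0"
proof -
  let ?q = "\<lambda>i \<omega>. D\<^sup>T *\<^sub>v adjoint_state y i \<omega>"
  have q: "?q i \<in> L2v i p" for i
    using adjoint_state_L2v[OF y] by (intro L2v_mult_mat[of _ p n]) auto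
  have sq: "adjoint_state y i \<omega> \<bullet> (D * D\<^sup>T *\<^sub>v adjoint_state y i \<omega>) = ?q i \<omega> \<bullet> ?q i \<omega>" for i \<omega>
  proof -
    have "D * D\<^sup>T *\<^sub>v adjoint_state y i \<omega> = D *\<^sub>v ?q i \<omega>"
      using y by (intro assoc_mult_mat_vec[of _ n p _ n]) auto
    then show ?thesis
      using y by (simp add: transpose_vec_mult_scalar[of _ n p] mult_mat_vec_carrier[of _ p n])
  qed
  have nonneg: "0 \<le> ?q i \<omega> \<bullet> ?q i \<omega>" for i \<omega>
    by (simp add: scalar_prod_def sum_nonneg)
  have "(\<Sum>i<Suc N. expectation (\<lambda>\<omega>. ?q i \<omega> \<bullet> ?q i \<omega>)) = y \<bullet> (step_gramian (Suc N) *\<^sub>v y)"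
    using y by (simp add: step_gramian_form expectation_adjoint_form flip: sq
        del: step_gramian.simps sum.lessThan_Suc)
  also have "\<dots> = 0" using ker y by simp
  finally have "expectation (\<lambda>\<omega>. ?q k \<omega> \<bullet> ?q k \<omega>) = 0"
    using k nonneg by (subst (asm) sum_nonneg_eq_0_iff) (auto intro: Bochner_Integration.integral_nonneg)
  then have "AE \<omega> in P. ?q k \<omega> \<bullet> ?q k \<omega> = 0"
    using nonneg L2v_scalar_prod(2)[OF q q]
    by (subst (asm) integral_nonneg_eq_0_iff_AE) auto
  then have "AE \<omega> in P. adjoint_state y k \<omega> \<bullet> (D *\<^sub>v v \<omega>) = 0"
  proof (rule AE_mp, intro AE_I2 impI)
    fix \<omega> assume \<omega>: "\<omega> \<in> space P" and 0: "?q k \<omega> \<bullet> ?q k \<omega> = 0"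
    have qc: "?q k \<omega> \<in> carrier_vec p" and vc: "v \<omega> \<in> carrier_vec p"
      by (rule L2v_carrier[OF q \<omega>], rule L2v_carrier[OF v \<omega>])
    have "?q k \<omega> = 0\<^sub>v p"
    proof (rule eq_vecI)
      fix i assume "i < dim_vec (0\<^sub>v p :: real Matrix.vec)"
      then show "?q k \<omega> $ i = 0\<^sub>v p $ i"
        using 0 carrier_matD[OF carrier(3)] unfolding scalar_prod_def
        by (subst (asm) sum_nonneg_eq_0_iff) (auto simp del: index_mult_mat_vec)
    qed (use carrier_vecD[OF qc] in simp)
    moreover have "?q k \<omega> \<bullet> v \<omega> = adjoint_state y k \<omega> \<bullet> (D *\<^sub>v v \<omega>)"
      using y vc by (intro transpose_vec_mult_scalar[of _ n p]) auto
    ultimately show "adjoint_state y k \<omega> \<bullet> (D *\<^sub>v v \<omega>) = 0"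
      using vc by simp
  qed
  then have "expectation (\<lambda>\<omega>. adjoint_state y k \<omega> \<bullet> (D *\<^sub>v v \<omega>)) = expectation (\<lambda>_. 0)"
    using L2v_scalar_prod(1)[OF adjoint_state_L2v[OF y] L2v_mult_mat[OF carrier(3) v]]
    by (intro integral_cong_AE) (auto intro: past_measurable)
  then show ?thesis by simp
qed

text \<open>The horizon \<open>M\<close> of the kernel may exceed the horizon \<open>N\<close> of
  the control, so that one \<open>M\<close> can serve several initial states.\<close>

lemma kernel_orthogonal_to_null_controlled:
  assumes y: "y \<in> carrier_vec n" and ker: "step_gramian (Suc M) *\<^sub>v y = 0\<^sub>v n" and NM: "N \<le> M"
    and x0: "x0 \<in> carrier_vec n"
    and v: "v \<in> l2_adapted P w N p" and x: "x \<in> l2_adapted P w (N + 1) n"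
    and z: "z \<in> l2_adapted P w N n"
    and eq: "backward_equation P w C Cbar D N x z v"
    and init: "AE \<omega> in P. x 0 \<omega> = x0" and final: "AE \<omega> in P. x (N + 1) \<omega> = 0\<^sub>v n"
  shows "y \<bullet> x0 = 0"
proof -
  have xL: "x k \<in> L2v k n" if "k \<le> Suc N" for k
    using x that by (simp add: l2_adapted_iff)
  \<comment> \<open>The pairing of adjoint state and solution changes only by the control term,
    which vanishes on the kernel; it is therefore conserved from time 0 to
    \<open>Suc N\<close>.\<close>
  have const: "expectation (\<lambda>\<omega>. adjoint_state y k \<omega> \<bullet> x k \<omega>) = y \<bullet> x0" if "k \<le> Suc N" for k
    using that
  proof (induction k)
    case 0
    have "expectation (\<lambda>\<omega>. y \<bullet> x 0 \<omega>) = expectation (\<lambda>_. y \<bullet> x0)"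
      using init past_measurable[OF L2v_scalar_prod(1)[OF L2v_const[OF y] xL[of 0]]]
      by (intro integral_cong_AE) auto
    then show ?case by (simp add: prob_space)
  next
    case (Suc k)
    then have k: "k \<le> N" by simp
    have vL: "v k \<in> L2v k p" and zL: "z k \<in> L2v k n"
      using v z k by (simp_all add: l2_adapted_iff)
    have "expectation (\<lambda>\<omega>. adjoint_state y (Suc k) \<omega> \<bullet> x (Suc k) \<omega>) =
        expectation (\<lambda>\<omega>. adjoint_state y k \<omega> \<bullet> x k \<omega>) -
        expectation (\<lambda>\<omega>. adjoint_state y k \<omega> \<bullet> (D *\<^sub>v v k \<omega>))"
      using eq k xL Suc.prems vL zL y
      by (intro adjoint_duality_step) (auto simp: backward_equation_def)
    also have "\<dots> = y \<bullet> x0"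
      using Suc adjoint_control_orthogonal[OF y ker _ vL] k NM by simp
    finally show ?case .
  qed
  have "y \<bullet> x0 = expectation (\<lambda>\<omega>. adjoint_state y (Suc N) \<omega> \<bullet> x (Suc N) \<omega>)"
    using const[of "Suc N"] by simp
  also have "\<dots> = expectation (\<lambda>_. 0)"
    using final y past_measurable[OF L2v_scalar_prod(1)[OF adjoint_state_L2v[OF y] xL[of "Suc N"]]]
    by (intro integral_cong_AE) (auto simp: scalar_prod_right_zero[of _ n] simp del: adjoint_state.simps)
  finally show ?thesis by simp
qed

text \<open>Controllability yields a horizon depending on the initial state. The finitely many unit
  vectors suffice, because orthogonality to all of them annihilates every coordinate of a kernel
  vector.\<close>

lemma invertible_gramian_if_controllable:
  assumes "exactly_null_controllable P w n p C Cbar D"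
  shows "\<exists>N>0. invertible_mat (gramian P w n C Cbar D N)"
proof -
  have "\<exists>N. \<forall>y\<in>carrier_vec n. \<forall>M\<ge>N. step_gramian (Suc M) *\<^sub>v y = 0\<^sub>v n \<longrightarrow> y $ i = 0" if "i < n" for i
  proof -
    have "unit_vec n i \<in> carrier_vec n" "unit_vec n i \<noteq> (0\<^sub>v n :: real Matrix.vec)"
      using that by auto
    with assms obtain N v x z where "v \<in> l2_adapted P w N p" "x \<in> l2_adapted P w (N + 1) n"
      "z \<in> l2_adapted P w N n" "backward_equation P w C Cbar D N x z v"
      "AE \<omega> in P. x 0 \<omega> = unit_vec n i" "AE \<omega> in P. x (N + 1) \<omega> = 0\<^sub>v n"
      unfolding exactly_null_controllable_def by blast
    from kernel_orthogonal_to_null_controlled[OF _ _ _ _ this]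
    have "y \<bullet> unit_vec n i = 0"
      if "y \<in> carrier_vec n" "N \<le> M" "step_gramian (Suc M) *\<^sub>v y = 0\<^sub>v n" for y M
      using that by (simp del: step_gramian.simps scalar_prod_right_unit)
    then show ?thesis using that by (auto simp del: step_gramian.simps)
  qed
  then obtain N where N: "\<And>i y M. i < n \<Longrightarrow> y \<in> carrier_vec n \<Longrightarrow> N i \<le> M \<Longrightarrow>
      step_gramian (Suc M) *\<^sub>v y = 0\<^sub>v n \<Longrightarrow> y $ i = 0"
    by metis
  \<comment> \<open>The sum dominates every single horizon, and \<open>Suc\<close> keeps
    \<open>M\<close> positive even for \<open>n = 0\<close>.\<close>
  define M where "M = Suc (\<Sum>i<n. N i)"
  have NM: "N i \<le> M" if "i < n" for i
    using member_le_sum[of i "{..<n}" N] that by (simp add: M_def)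
  have "y = 0\<^sub>v n" if y: "y \<in> carrier_vec n" and ker: "step_gramian (Suc M) *\<^sub>v y = 0\<^sub>v n" for y
    using N[OF _ y NM ker] y by (intro eq_vecI) auto
  then have "invertible_mat (step_gramian (Suc M))"
    by (subst invertible_mat_iff_kernel[OF step_gramian_carrier]) blast
  then show ?thesis
    by (intro exI[of _ M]) (simp add: gramian_eq_step_gramian M_def del: step_gramian.simps)
qed

section \<open>Sufficiency: a feedback control built from the Gramian\<close>

lemma step_gramian_feedback:
  assumes S: "S \<in> carrier_mat n n" and r: "r \<in> carrier_vec n"
  shows "(D * D\<^sup>T + moment_step S) *\<^sub>v r =
    C *\<^sub>v (S *\<^sub>v (C\<^sup>T *\<^sub>v r + c \<cdot>\<^sub>v (Cbar\<^sup>T *\<^sub>v r))) + Cbar *\<^sub>v (S *\<^sub>v (Cbar\<^sup>T *\<^sub>v r)) +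
    D *\<^sub>v (D\<^sup>T *\<^sub>v r) - c \<cdot>\<^sub>v (C *\<^sub>v (S *\<^sub>v (Cbar\<^sup>T *\<^sub>v r)))"
proof -
  \<comment> \<open>Here \<open>c\<close> stands for the value of \<open>w k\<close>. The noise part
    of the next adjoint state contributes \<open>c \<cdot>\<^sub>v ?s\<close>, which is exactly what
    the last term of the equation subtracts; the rest is the recursion for
    \<open>step_gramian\<close>. The identity holds for every real \<open>c\<close>, hence pointwise
    in the sample.\<close>
  let ?p = "C *\<^sub>v (S *\<^sub>v (C\<^sup>T *\<^sub>v r))" and ?q = "Cbar *\<^sub>v (S *\<^sub>v (Cbar\<^sup>T *\<^sub>v r))"
    and ?d = "D *\<^sub>v (D\<^sup>T *\<^sub>v r)" and ?s = "C *\<^sub>v (S *\<^sub>v (Cbar\<^sup>T *\<^sub>v r))"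
  have "D * D\<^sup>T *\<^sub>v r = ?d" using r by (intro assoc_mult_mat_vec[of _ n p _ n]) auto
  then have "(D * D\<^sup>T + moment_step S) *\<^sub>v r = ?d + (?p + ?q)"
    using S r by (simp add: add_mult_distrib_mat_vec[of _ n n] moment_step_mult_vec)
  moreover have "C *\<^sub>v (S *\<^sub>v (C\<^sup>T *\<^sub>v r + c \<cdot>\<^sub>v (Cbar\<^sup>T *\<^sub>v r))) = ?p + c \<cdot>\<^sub>v ?s"
    using S r by (simp add: mult_add_distrib_mat_vec[of _ n n] mult_mat_vec[of _ n n])
  moreover have "?d + (?p + ?q) = ?p + c \<cdot>\<^sub>v ?s + ?q + ?d - c \<cdot>\<^sub>v ?s"
    using carrier_matD[OF carrier(1)] carrier_matD[OF carrier(2)] carrier_matD[OF carrier(3)]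
    by (intro eq_vecI) (simp_all del: index_mult_mat_vec)
  ultimately show ?thesis by simp
qed

lemma controllable_if_invertible_gramian:
  assumes N: "N > 0" and inv: "invertible_mat (gramian P w n C Cbar D N)"
  shows "exactly_null_controllable P w n p C Cbar D"
  unfolding exactly_null_controllable_def
proof (intro ballI impI)
  fix x0 :: "real Matrix.vec" assume "x0 \<in> carrier_vec n"
  with inv obtain y where y: "y \<in> carrier_vec n" and y_x0: "step_gramian (Suc N) *\<^sub>v y = x0"
    unfolding gramian_eq_step_gramian by (rule invertible_mat_surj[OF step_gramian_carrier])
  define v where "v k \<omega> = D\<^sup>T *\<^sub>v adjoint_state y k \<omega>" for k \<omega>
  define x where "x k \<omega> = step_gramian (Suc N - k) *\<^sub>v adjoint_state y k \<omega>" for k \<omega>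
  define z where "z k \<omega> = step_gramian (N - k) *\<^sub>v (Cbar\<^sup>T *\<^sub>v adjoint_state y k \<omega>)" for k \<omega>
  have "v \<in> l2_adapted P w N p" "x \<in> l2_adapted P w (N + 1) n" "z \<in> l2_adapted P w N n"
    unfolding l2_adapted_iff v_def x_def z_def using adjoint_state_L2v[OF y]
    by (auto intro!: L2v_mult_mat[of _ n n] L2v_mult_mat[of _ p n] simp del: step_gramian.simps)
  moreover have "backward_equation P w C Cbar D N x z v"
    unfolding backward_equation_def
  proof (intro ballI AE_I2)
    fix k \<omega> assume "k \<in> {0..N}"
    \<comment> \<open>For \<open>k \<le> N\<close> at least one step remains, so the truncated
      difference is a successor and the recursion unfolds.\<close>
    then have "Suc N - k = Suc (N - k)" by auto
    then show "x k \<omega> = C *\<^sub>v x (k + 1) \<omega> + Cbar *\<^sub>v z k \<omega> + D *\<^sub>v v k \<omega> - w k \<omega> \<cdot>\<^sub>v (C *\<^sub>v z k \<omega>)"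
      using step_gramian_feedback[of "step_gramian (N - k)" "adjoint_state y k \<omega>" "w k \<omega>"] y
      by (simp add: x_def z_def v_def)
  qed
  moreover have "x 0 \<omega> = x0" for \<omega>
    using y_x0 by (simp add: x_def del: step_gramian.simps)
  \<comment> \<open>At time \<open>N + 1\<close> no step remains, and \<open>step_gramian 0\<close>
    is the zero matrix.\<close>
  moreover have "x (N + 1) \<omega> = 0\<^sub>v n" for \<omega>
    using adjoint_state_carrier[OF y, of "Suc N" \<omega>]
    by (intro eq_vecI) (auto simp: x_def simp del: adjoint_state.simps)
  ultimately show "\<exists>N>0. \<exists>v\<in>l2_adapted P w N p. \<exists>x\<in>l2_adapted P w (N + 1) n. \<exists>z\<in>l2_adapted P w N n.
      backward_equation P w C Cbar D N x z v \<and> (AE \<omega> in P. x 0 \<omega> = x0) \<and>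
      (AE \<omega> in P. x (N + 1) \<omega> = 0\<^sub>v n)"
    using N by (intro exI[of _ N] conjI bexI[of _ v] bexI[of _ x] bexI[of _ z]) auto
qed

end

theorem theorem1:
  fixes P :: "'a measure" and w :: "nat \<Rightarrow> 'a \<Rightarrow> real"
    and n m :: nat
    and A Abar B Bbar M L F C Cbar D :: "real mat"
  assumes "prob_space P" and "complete_measure P" and "standard_noise P w"
    and "A \<in> carrier_mat n n" and "Abar \<in> carrier_mat n n"
    and "B \<in> carrier_mat n m" and "Bbar \<in> carrier_mat n m"
    and "vec_space.rank n Bbar = n"
    and "M \<in> carrier_mat m m" and "invertible_mat M"
    and "Bbar * M = 1\<^sub>m n @\<^sub>c 0\<^sub>m n (m - n)"
    and "L \<in> carrier_mat n n" and "F \<in> carrier_mat n (m - n)"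
    and "B * M = L @\<^sub>c F"
    and "invertible_mat (A - L * Abar)"
    and "C \<in> carrier_mat n n"
    and "inverts_mat C (A - L * Abar)" and "inverts_mat (A - L * Abar) C"
    and "Cbar = - (C * L)"
    and "D = - (C * F)"
  shows "exactly_null_controllable P w n (m - n) C Cbar D \<longleftrightarrow>
    (\<exists>N>0. invertible_mat (gramian P w n C Cbar D N))"
proof -
  have "A - L * Abar \<in> carrier_mat n n"
    using assms by (intro minus_carrier_mat mult_carrier_mat[of _ n n])
  \<comment> \<open>The matrix \<open>A - L * Abar\<close> takes the place of \<open>K\<close>, the
    inverse of \<open>C\<close>, and the control has dimension \<open>m - n\<close>.\<close>
  then interpret backward_system P w n "m - n" C Cbar D "A - L * Abar"
    using assms
    by (auto simp: backward_system_def backward_system_axioms_def noise_def noise_axioms_def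
        inverts_mat_def intro!: mult_carrier_mat[of _ n n])
  show ?thesis
    using invertible_gramian_if_controllable controllable_if_invertible_gramian by blast
qed

end
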